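(* Let $\alpha=2^{-1/2}$. For every integer $m\ge 0$ there exist absolute constants $\tilde C_m>0$ and $C_m>0$ (depending only on $m$) such that the following holds. Let $(P_{-1},P_0)$ be a pair of real polynomials having a $(1,1)$-regular $\rho$-germ at a point $x_0\in\mathbb{R}$ (for some $\rho>0$). Define $P_k=P_{k-2}^2(P_{k-1}-2)+2$ for $k\ge1$, and for $k\ge-1$ define $Q_k(x)=P_k\left(\frac{x}{2^k\rho}+x_0\right)$ and $\Delta_k(x)=Q_k(x)-2\cos x$. Then for every $k\ge 2m+1$ and every $x\in[-2^{m-1}\pi,2^{m-1}\pi]$, $$|\Delta_k(x)|\le \tilde C_m\,\alpha^k|x|^3\le C_m\,\alpha^k.$$
   Context: Formal series notation: for real formal power series $f=\sum_{n\ge0}a_nx^n$, $g=\sum_{n\ge 0}b_nx^n$, write $f\preceq g$ if $a_n\le b_n$ for all $n\ge0$, and $|f|^\ast:=\sum_{n\ge0}|a_n|x^n$. Germs: a pair of real polynomials $(P_{-1},P_0)$ has a $\rho$-germ at $x_0\in\mathbb{R}$, where $\rho>0$, if $P_{-1}(x)=2-\frac{\rho^2}{4}(x-x_0)^2+O((x-x_0)^3)$ and $P_0(x)=2-\rho^2(x-x_0)^2+O((x-x_0)^3)$ as $x\to x_0$. Regularity: suppose $(P_{-1},P_0)$ has a $\rho$-germ at $x_0$. For $k=-1,0$ put $Q_k(x)=P_k\left(\frac{x}{2^k\rho}+x_0\right)$ and $\Delta_k(x)=Q_k(x)-2\cos x$, viewed as a power series in $x$ (it starts at order $x^3$). For $\delta>0$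 and $\beta\ge1$, the germ is called $(\delta,\beta)$-regular if $|\Delta_{-1}|^\ast\preceq\delta\sum_{n\ge3}\frac{x^n}{\beta^n}$ and $|\Delta_0|^\ast\preceq\delta\sum_{n\ge3}\frac{x^n}{\beta^n}$. *)

theory Defs
  imports "HOL-Analysis.FPS_Convergence" "HOL-Library.Landau_Symbols"
    "HOL-Computational_Algebra.Polynomial_FPS"
begin

definition fps_le :: "real fps \<Rightarrow> real fps \<Rightarrow> bool"  (infix \<open>\<preceq>\<close> 50) where
  "f \<preceq> g \<longleftrightarrow> (\<forall>n. fps_nth f n \<le> fps_nth g n)"

text \<open>The series \<open>|f|\<^sup>*\<close> of absolute values of the coefficients.\<close>
definition fps_abs :: "real fps \<Rightarrow> real fps" where
  "fps_abs f = Abs_fps (\<lambda>n. \<bar>fps_nth f n\<bar>)"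

text \<open>\<open>Pm1\<close> and \<open>P0\<close> stand for the polynomials with index \<open>-1\<close> and \<open>0\<close>.\<close>
definition has_germ :: "real \<Rightarrow> real \<Rightarrow> real poly \<Rightarrow> real poly \<Rightarrow> bool" where
  "has_germ \<rho> x0 Pm1 P0 \<longleftrightarrow>
     \<rho> > 0 \<and>
     (\<lambda>x. poly Pm1 x - (2 - \<rho>\<^sup>2 / 4 * (x - x0)\<^sup>2)) \<in> O[at x0](\<lambda>x. (x - x0) ^ 3) \<and>
     (\<lambda>x. poly P0 x - (2 - \<rho>\<^sup>2 * (x - x0)\<^sup>2)) \<in> O[at x0](\<lambda>x. (x - x0) ^ 3)"

text \<open>
  With \<open>p = P\<^sub>k\<close> this is \<open>Q\<^sub>k\<close>. The index is an integer since it starts at \<open>-1\<close>; the scale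
  \<open>2 powi k * \<rho>\<close> is nonzero for every \<open>\<rho>\<close> admitted by \<open>has_germ\<close>.
\<close>
definition rescaled :: "real \<Rightarrow> real \<Rightarrow> int \<Rightarrow> real poly \<Rightarrow> real poly" where
  "rescaled \<rho> x0 k p = pcompose p [:x0, 1 / (2 powi k * \<rho>):]"

lemma poly_rescaled: "poly (rescaled \<rho> x0 k p) x = poly p (x / (2 powi k * \<rho>) + x0)"
  by (simp add: rescaled_def poly_pcompose add.commute)

definition Delta :: "real \<Rightarrow> real \<Rightarrow> int \<Rightarrow> real poly \<Rightarrow> real \<Rightarrow> real" where
  "Delta \<rho> x0 k p x = poly (rescaled \<rho> x0 k p) x - 2 * cos x"

text \<open>
  \<open>Delta\<close> as a formal power series; \<open>Delta_has_fps_expansion\<close> below shows that the two agree.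
\<close>
definition Delta_fps :: "real \<Rightarrow> real \<Rightarrow> int \<Rightarrow> real poly \<Rightarrow> real fps" where
  "Delta_fps \<rho> x0 k p = fps_of_poly (rescaled \<rho> x0 k p) - fps_const 2 * fps_cos 1"

lemma Delta_has_fps_expansion: "Delta \<rho> x0 k p has_fps_expansion Delta_fps \<rho> x0 k p"
proof -
  have poly: "poly q has_fps_expansion fps_of_poly q" for q :: "real poly"
    by (auto simp: has_fps_expansion_def)
  have cos: "cos has_fps_expansion fps_cos (1::real)"
    using has_fps_expansion_cos[of 1] by simp
  have "(\<lambda>x. poly (rescaled \<rho> x0 k p) x - 2 * cos x) has_fps_expansion Delta_fps \<rho> x0 k p"
    unfolding Delta_fps_def by (intro fps_expansion_intros poly cos)
  then show ?thesis
    by (simp add: Delta_def[abs_def])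
qed

definition regular_germ :: "real \<Rightarrow> real \<Rightarrow> real \<Rightarrow> real \<Rightarrow> real poly \<Rightarrow> real poly \<Rightarrow> bool" where
  "regular_germ \<delta> \<beta> \<rho> x0 Pm1 P0 \<longleftrightarrow>
     \<delta> > 0 \<and> \<beta> \<ge> 1 \<and> has_germ \<rho> x0 Pm1 P0 \<and>
     fps_abs (Delta_fps \<rho> x0 (-1) Pm1) \<preceq> fps_const \<delta> * Abs_fps (\<lambda>n. if n \<ge> 3 then 1 / \<beta> ^ n else 0) \<and>
     fps_abs (Delta_fps \<rho> x0 0 P0) \<preceq> fps_const \<delta> * Abs_fps (\<lambda>n. if n \<ge> 3 then 1 / \<beta> ^ n else 0)"

end

theory Submission
  imports Defs
begin

text \<open>
  The function \<open>2 cos\<close> satisfies the rescaled recurrence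
  \<open>Q\<^sub>k(x) = Q\<^sub>k\<^sub>-\<^sub>2(x/4)\<^sup>2 (Q\<^sub>k\<^sub>-\<^sub>1(x/2) - 2) + 2\<close> exactly, so
  \<open>\<bar>\<Delta>\<^sub>k(x)\<bar>\<close> is at most \<open>4 \<bar>\<Delta>\<^sub>k\<^sub>-\<^sub>1(x/2)\<bar>\<close> plus a term carrying the extra factor
  \<open>x\<^sup>2/4 + \<bar>\<Delta>\<^sub>k\<^sub>-\<^sub>1(x/2)\<bar>\<close>. On cubic errors, halving the argument gains \<open>1/8\<close>, so the main term
  contracts by \<open>1/2 < \<alpha>\<close>. For \<open>\<bar>x\<bar> \<le> \<pi>/4\<close> the other term is small enough for
  \<open>\<bar>\<Delta>\<^sub>k(x)\<bar> \<le> 5 \<alpha>\<^sup>k \<bar>x\<bar>\<^sup>3\<close> to propagate from \<open>k = -1, 0\<close> to all \<open>k\<close>. Thereafter each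
  application of the recurrence doubles the interval at the cost of a larger constant.
\<close>

section \<open>Cubic bounds from the power series majorant\<close>

lemma sums_Delta: "(\<lambda>n. fps_nth (Delta_fps \<rho> x0 k p) n * x ^ n) sums Delta \<rho> x0 k p x"
proof -
  have "(\<lambda>n. poly.coeff q n * x ^ n) sums poly q x" for q :: "real poly"
    unfolding poly_altdef by (rule sums_finite) (auto simp: coeff_eq_0)
  moreover have "(\<lambda>n. fps_nth (fps_cos 1) n * x ^ n) sums cos x"
    using cos_converges[of x]
    by (simp add: fps_cos_def cos_coeff_def if_distrib[of "\<lambda>u. u * _"] cong: if_cong)
  ultimately have "(\<lambda>n. poly.coeff (rescaled \<rho> x0 k p) n * x ^ n - 2 * (fps_nth (fps_cos 1) n * x ^ n))
      sums (poly (rescaled \<rho> x0 k p) x - 2 * cos x)"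
    by (intro sums_diff sums_mult)
  then show ?thesis
    by (simp add: Delta_def Delta_fps_def algebra_simps)
qed

text \<open>The majorant makes the coefficients of order below 3 vanish and bounds the others by 1,
  so a geometric series starting at order 3 dominates.\<close>

lemma abs_Delta_le:
  assumes "fps_abs (Delta_fps \<rho> x0 k p) \<preceq> Abs_fps (\<lambda>n. if n \<ge> 3 then 1 else 0)"
    and "\<bar>x\<bar> < 1"
  shows "\<bar>Delta \<rho> x0 k p x\<bar> \<le> \<bar>x\<bar> ^ 3 / (1 - \<bar>x\<bar>)"
proof -
  let ?F = "\<lambda>n. fps_nth (Delta_fps \<rho> x0 k p) n"
  have F: "\<bar>?F n\<bar> \<le> (if n \<ge> 3 then 1 else 0)" for n
    using assms(1) by (auto simp: fps_le_def fps_abs_def dest!: spec[of _ n])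
  have "(\<lambda>n. \<bar>x\<bar> ^ 3 * \<bar>x\<bar> ^ n) sums (\<bar>x\<bar> ^ 3 * (1 / (1 - \<bar>x\<bar>)))"
    using assms(2) by (intro sums_mult geometric_sums) auto
  moreover have "(\<lambda>n. ?F (n + 3) * x ^ (n + 3)) sums Delta \<rho> x0 k p x"
  proof -
    have "(\<Sum>n<3. ?F n * x ^ n) = 0"
    proof (intro sum.neutral ballI)
      show "?F n * x ^ n = 0" if "n \<in> {..<3}" for n
        using F[of n] that by simp
    qed
    then show ?thesis
      using sums_Delta[of \<rho> x0 k p x] by (subst sums_iff_shift) simp
  qed
  moreover have "\<bar>?F (n + 3) * x ^ (n + 3)\<bar> \<le> \<bar>x\<bar> ^ 3 * \<bar>x\<bar> ^ n" for n
    using mult_right_mono[OF F[of "n + 3"], of "\<bar>x\<bar> ^ (n + 3)"]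
    by (simp add: abs_mult power_abs power_add mult.commute)
  ultimately show ?thesis
    using norm_suminf_le[of "\<lambda>n. ?F (n + 3) * x ^ (n + 3)" "\<lambda>n. \<bar>x\<bar> ^ 3 * \<bar>x\<bar> ^ n"]
    by (auto simp: sums_iff)
qed

section \<open>One step of the recurrence for the errors\<close>

lemma Delta_recurrence:
  assumes "\<rho> > 0" and P: "p = p2\<^sup>2 * (p1 - 2) + 2"
  shows "Delta \<rho> x0 k p x =
    (2 * cos (x / 4) + Delta \<rho> x0 (k - 2) p2 (x / 4))\<^sup>2 *
      (2 * cos (x / 2) - 2 + Delta \<rho> x0 (k - 1) p1 (x / 2)) -
    (2 * cos (x / 4))\<^sup>2 * (2 * cos (x / 2) - 2)"
proof -
  \<comment> \<open>All three levels evaluate the original polynomials at the same point, so their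
    recurrence applies pointwise.\<close>
  have scale: "poly (rescaled \<rho> x0 (k - 1) q) (x / 2) = poly (rescaled \<rho> x0 k q) x"
    "poly (rescaled \<rho> x0 (k - 2) q) (x / 4) = poly (rescaled \<rho> x0 k q) x" for q
    by (simp_all add: poly_rescaled power_int_diff)
  have "(2 * cos (x / 4))\<^sup>2 = 2 + 2 * cos (x / 2)" "2 * cos x = 4 * (cos (x / 2))\<^sup>2 - 2"
    using cos_double_cos[of "x / 4"] cos_double_cos[of "x / 2"] by (simp_all add: power_mult_distrib)
  then have "2 * cos x = (2 * cos (x / 4))\<^sup>2 * (2 * cos (x / 2) - 2) + 2"
    by (simp add: power2_eq_square algebra_simps)
  then show ?thesis
    by (simp add: Delta_def scale) (simp add: poly_rescaled P)
qed

lemma perturbation_bound: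
  fixes x d1 d2 :: real
  shows "\<bar>(2 * cos (x / 4) + d2)\<^sup>2 * (2 * cos (x / 2) - 2 + d1) - (2 * cos (x / 4))\<^sup>2 * (2 * cos (x / 2) - 2)\<bar>
    \<le> 4 * \<bar>d1\<bar> + (4 + \<bar>d2\<bar>) * \<bar>d2\<bar> * (x\<^sup>2 / 4 + \<bar>d1\<bar>)"
proof -
  define c where "c = 2 * cos (x / 4)"
  define b where "b = 2 * cos (x / 2) - 2"
  have c: "\<bar>c\<bar> \<le> 2"
    using abs_cos_le_one[of "x / 4"] by (simp add: c_def abs_mult del: abs_cos_le_one)
  \<comment> \<open>This form makes \<open>b\<close> quadratically small in \<open>x\<close>, which
    keeps the contribution of \<open>d2\<close> small near 0.\<close>
  have "b = - 4 * (sin (x / 4))\<^sup>2"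
    using cos_double_sin[of "x / 4"] by (simp add: b_def)
  moreover have "(sin (x / 4))\<^sup>2 \<le> (x / 4)\<^sup>2"
    unfolding abs_le_square_iff[symmetric] by (rule abs_sin_x_le_abs_x)
  ultimately have b: "\<bar>b\<bar> \<le> x\<^sup>2 / 4"
    by (simp add: power_divide)
  have "\<bar>(c + d2)\<^sup>2 * (b + d1) - c\<^sup>2 * b\<bar> = \<bar>c\<^sup>2 * d1 + (2 * c + d2) * d2 * (b + d1)\<bar>"
    by (simp add: power2_eq_square algebra_simps)
  also have "\<dots> \<le> \<bar>c\<^sup>2 * d1\<bar> + \<bar>(2 * c + d2) * d2 * (b + d1)\<bar>"
    by (rule abs_triangle_ineq)
  also have "\<dots> = \<bar>c\<bar>\<^sup>2 * \<bar>d1\<bar> + \<bar>2 * c + d2\<bar> * \<bar>d2\<bar> * \<bar>b + d1\<bar>"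
    by (simp add: abs_mult)
  also have "\<dots> \<le> 2\<^sup>2 * \<bar>d1\<bar> + (4 + \<bar>d2\<bar>) * \<bar>d2\<bar> * (x\<^sup>2 / 4 + \<bar>d1\<bar>)"
    using b c by (intro add_mono mult_mono power_mono) auto
  finally show ?thesis
    by (simp add: b_def c_def)
qed

text \<open>The factor by which one recurrence step on \<open>\<bar>x\<bar> \<le> T\<close>
  multiplies the constant \<open>M\<close> of a bound
  \<open>M * \<alpha> powi k * \<bar>x\<bar> ^ 3\<close>. The summand \<open>3 / 4\<close> bounds
  \<alpha>, the share of the term linear in the level \<open>k - 1\<close> error; the product covers
  the rest.\<close>

definition step_factor :: "real \<Rightarrow> real \<Rightarrow> real" where
  "step_factor M T = 3 / 4 + (1 / 8 + M * T ^ 3 / 1024) * (T\<^sup>2 / 4 + M * T ^ 3 / 4)"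

text \<open>
  Here \<open>a\<close> stands for \<open>\<alpha>\<^sup>k\<close>, and the bound \<open>3 / 4\<close> on \<open>\<alpha>\<close> is small enough to give
  \<open>step_factor 5 (4 / 5) \<le> 1\<close>, where \<open>4 / 5 > \<pi> / 4\<close>.
\<close>
lemma contraction_step:
  fixes \<alpha> M T a x d d1 d2 :: real
  assumes \<alpha>: "0 < \<alpha>" "\<alpha> \<le> 3 / 4" "\<alpha>\<^sup>2 = 1 / 2" and a: "0 \<le> a" "a \<le> 1" and M: "0 \<le> M" and x: "\<bar>x\<bar> \<le> T"
    and d1: "\<bar>d1\<bar> \<le> M * (a / \<alpha>) * \<bar>x / 2\<bar> ^ 3" and d2: "\<bar>d2\<bar> \<le> M * (a / \<alpha>\<^sup>2) * \<bar>x / 4\<bar> ^ 3"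
    and d: "\<bar>d\<bar> \<le> 4 * \<bar>d1\<bar> + (4 + \<bar>d2\<bar>) * \<bar>d2\<bar> * (x\<^sup>2 / 4 + \<bar>d1\<bar>)"
  shows "\<bar>d\<bar> \<le> step_factor M T * M * a * \<bar>x\<bar> ^ 3"
proof -
  define E where "E = M * a * \<bar>x\<bar> ^ 3"
  have E: "0 \<le> E" "E \<le> M * T ^ 3"
  proof -
    show "0 \<le> E" using M a by (simp add: E_def)
    have "M * a * \<bar>x\<bar> ^ 3 \<le> M * 1 * T ^ 3"
      using M a x by (intro mult_mono power_mono) auto
    then show "E \<le> M * T ^ 3" by (simp add: E_def)
  qed
  \<comment> \<open>Lowering the index by 1 costs \<open>1 / \<alpha> = 2 * \<alpha>\<close> and
    halving \<open>x\<close> gains \<open>1 / 8\<close>, so \<open>\<alpha> / 4\<close>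
    remains.\<close>
  have inv: "1 / \<alpha> = 2 * \<alpha>"
    using \<alpha> by (simp add: field_simps power2_eq_square)
  have "M * (a / \<alpha>) * \<bar>x / 2\<bar> ^ 3 = (1 / \<alpha>) * (E / 8)"
    by (simp add: E_def power_divide)
  also have "\<dots> = \<alpha> * (E / 4)"
    unfolding inv by simp
  finally have d1': "\<bar>d1\<bar> \<le> \<alpha> * (E / 4)"
    using d1 by (simp only:)
  \<comment> \<open>Here the cost is \<open>1 / \<alpha>\<^sup>2 = 2\<close> and the gain
    \<open>1 / 64\<close>.\<close>
  have d2': "\<bar>d2\<bar> \<le> E / 32"
    using d2 \<alpha>(3) by (simp add: E_def power_divide)
  have d1'': "\<bar>d1\<bar> \<le> 3 / 4 * (E / 4)"
    using d1' mult_right_mono[OF \<alpha>(2), of "E / 4"] E(1) by linarith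
  have "x\<^sup>2 \<le> T\<^sup>2"
    using x by (simp add: power2_le_iff_abs_le)
  have "(4 + \<bar>d2\<bar>) * \<bar>d2\<bar> * (x\<^sup>2 / 4 + \<bar>d1\<bar>)
      \<le> (4 + M * T ^ 3 / 32) * (E / 32) * (T\<^sup>2 / 4 + M * T ^ 3 / 4)"
    using d1'' d2' E \<open>x\<^sup>2 \<le> T\<^sup>2\<close> by (intro mult_mono add_mono) (auto intro: order_trans)
  then have "\<bar>d\<bar> \<le> 3 / 4 * E + (4 + M * T ^ 3 / 32) * (E / 32) * (T\<^sup>2 / 4 + M * T ^ 3 / 4)"
    using d d1'' by linarith
  also have "\<dots> = step_factor M T * E"
    by (simp add: step_factor_def algebra_simps)
  finally show ?thesis
    by (simp add: E_def mult.assoc)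
qed

section \<open>Iteration of the error estimate\<close>

lemma powi_step:
  fixes \<alpha> :: real
  assumes "\<alpha> \<noteq> 0"
  shows "\<alpha> powi (k - 1) = \<alpha> powi k / \<alpha>" "\<alpha> powi (k - 2) = \<alpha> powi k / \<alpha>\<^sup>2"
  using assms by (simp_all add: power_int_diff)

text \<open>Neither the polynomials nor \<rho> and \<open>x0\<close> occur here, so a constant valid
  for every such \<open>D\<close> is absolute.\<close>

definition error_system :: "(int \<Rightarrow> real \<Rightarrow> real) \<Rightarrow> bool" where
  "error_system D \<longleftrightarrow>
    (\<forall>k\<ge>1. \<forall>x. \<bar>D k x\<bar> \<le> 4 * \<bar>D (k - 1) (x / 2)\<bar> +
      (4 + \<bar>D (k - 2) (x / 4)\<bar>) * \<bar>D (k - 2) (x / 4)\<bar> * (x\<^sup>2 / 4 + \<bar>D (k - 1) (x / 2)\<bar>)) \<and>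
    (\<forall>x. \<bar>x\<bar> \<le> pi / 4 \<longrightarrow> \<bar>D (-1) x\<bar> \<le> 5 * \<bar>x\<bar> ^ 3 \<and> \<bar>D 0 x\<bar> \<le> 5 * \<bar>x\<bar> ^ 3)"

lemma error_system_Delta:
  assumes reg: "regular_germ 1 1 \<rho> x0 (P (-1)) (P 0)"
    and P: "\<forall>k\<ge>1. P k = (P (k - 2))\<^sup>2 * (P (k - 1) - 2) + 2"
  shows "error_system (\<lambda>k. Delta \<rho> x0 k (P k))"
proof -
  have "\<rho> > 0"
    using reg by (simp add: regular_germ_def has_germ_def)
  have cubic: "\<bar>Delta \<rho> x0 k p x\<bar> \<le> 5 * \<bar>x\<bar> ^ 3"
    if maj: "fps_abs (Delta_fps \<rho> x0 k p) \<preceq> Abs_fps (\<lambda>n. if n \<ge> 3 then 1 else 0)"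
      and x: "\<bar>x\<bar> \<le> pi / 4" for k p x
  proof -
    \<comment> \<open>The constant 5 arises here:
      \<open>1 - \<bar>x\<bar> \<ge> 1 / 5\<close>.\<close>
    have x: "\<bar>x\<bar> \<le> 4 / 5"
      using x pi_approx by simp
    then have "\<bar>x\<bar> ^ 3 / (1 - \<bar>x\<bar>) \<le> \<bar>x\<bar> ^ 3 / (1 / 5)"
      by (intro divide_left_mono) auto
    then show ?thesis
      using abs_Delta_le[OF maj, of x] x by simp
  qed
  have "\<bar>Delta \<rho> x0 k (P k) x\<bar> \<le> 4 * \<bar>Delta \<rho> x0 (k - 1) (P (k - 1)) (x / 2)\<bar> +
      (4 + \<bar>Delta \<rho> x0 (k - 2) (P (k - 2)) (x / 4)\<bar>) * \<bar>Delta \<rho> x0 (k - 2) (P (k - 2)) (x / 4)\<bar> *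
      (x\<^sup>2 / 4 + \<bar>Delta \<rho> x0 (k - 1) (P (k - 1)) (x / 2)\<bar>)" if "k \<ge> 1" for k x
    unfolding Delta_recurrence[OF \<open>\<rho> > 0\<close> P[rule_format, OF that]]
    by (rule perturbation_bound)
  moreover have "\<bar>Delta \<rho> x0 (-1) (P (-1)) x\<bar> \<le> 5 * \<bar>x\<bar> ^ 3 \<and> \<bar>Delta \<rho> x0 0 (P 0) x\<bar> \<le> 5 * \<bar>x\<bar> ^ 3"
    if "\<bar>x\<bar> \<le> pi / 4" for x
    using reg that by (simp add: regular_germ_def cubic cong: if_cong)
  ultimately show ?thesis
    unfolding error_system_def by blast
qed

lemma error_system_step:
  assumes \<alpha>: "0 < \<alpha>" "\<alpha> \<le> 3 / 4" "\<alpha>\<^sup>2 = 1 / 2" and D: "error_system D"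
    and "0 \<le> M" "\<bar>x\<bar> \<le> T" "k \<ge> 1"
    and "\<bar>D (k - 1) (x / 2)\<bar> \<le> M * \<alpha> powi (k - 1) * \<bar>x / 2\<bar> ^ 3"
    and "\<bar>D (k - 2) (x / 4)\<bar> \<le> M * \<alpha> powi (k - 2) * \<bar>x / 4\<bar> ^ 3"
  shows "\<bar>D k x\<bar> \<le> step_factor M T * M * \<alpha> powi k * \<bar>x\<bar> ^ 3"
proof (rule contraction_step[OF \<alpha>])
  show "\<alpha> powi k \<le> 1"
    using \<alpha> \<open>k \<ge> 1\<close> by (simp add: power_int_def power_le_one)
  show "\<bar>D k x\<bar> \<le> 4 * \<bar>D (k - 1) (x / 2)\<bar> +
      (4 + \<bar>D (k - 2) (x / 4)\<bar>) * \<bar>D (k - 2) (x / 4)\<bar> * (x\<^sup>2 / 4 + \<bar>D (k - 1) (x / 2)\<bar>)"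
    using D \<open>k \<ge> 1\<close> by (simp add: error_system_def)
qed (use assms in \<open>simp_all add: powi_step\<close>)

text \<open>Strong induction on the index, shifted by 1 to start at -1. The constant 5 reproduces
  itself because its step factor is at most 1.\<close>

lemma error_system_base:
  assumes \<alpha>: "0 < \<alpha>" "\<alpha> \<le> 3 / 4" "\<alpha>\<^sup>2 = 1 / 2" and D: "error_system D"
    and "k \<ge> -1" "\<bar>x\<bar> \<le> pi / 4"
  shows "\<bar>D k x\<bar> \<le> 5 * \<alpha> powi k * \<bar>x\<bar> ^ 3"
proof -
  have "\<bar>D (int n - 1) x\<bar> \<le> 5 * \<alpha> powi (int n - 1) * \<bar>x\<bar> ^ 3" if "\<bar>x\<bar> \<le> pi / 4" for n x
    using that
  proof (induction n arbitrary: x rule: less_induct)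
    case (less n)
    consider "n = 0" | "n = 1" | "n \<ge> 2" by linarith
    then show ?case
    proof cases
      case 1
      have "1 \<le> 1 / \<alpha>"
        using \<alpha> by simp
      then have "5 * \<bar>x\<bar> ^ 3 \<le> 5 * (1 / \<alpha>) * \<bar>x\<bar> ^ 3"
        by (intro mult_right_mono) auto
      moreover have "\<bar>D (-1) x\<bar> \<le> 5 * \<bar>x\<bar> ^ 3"
        using D less.prems by (simp add: error_system_def)
      ultimately show ?thesis
        using 1 by (simp add: power_int_minus field_simps)
    next
      case 2
      then show ?thesis
        using D less.prems by (simp add: error_system_def)
    next
      case 3
      \<comment> \<open>A rational bound in place of \<open>pi / 4\<close> lets the step factor be
        evaluated exactly; it is 0.852.\<close>
      have "\<bar>x\<bar> \<le> 4 / 5"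
        using less.prems pi_approx by simp
      moreover have "\<bar>D (int n - 1 - 1) (x / 2)\<bar> \<le> 5 * \<alpha> powi (int n - 1 - 1) * \<bar>x / 2\<bar> ^ 3"
        using less.IH[of "n - 1" "x / 2"] 3 less.prems by (simp add: of_nat_diff)
      moreover have "\<bar>D (int n - 1 - 2) (x / 4)\<bar> \<le> 5 * \<alpha> powi (int n - 1 - 2) * \<bar>x / 4\<bar> ^ 3"
        using less.IH[of "n - 2" "x / 4"] 3 less.prems by (simp add: of_nat_diff algebra_simps)
      ultimately have "\<bar>D (int n - 1) x\<bar> \<le> step_factor 5 (4 / 5) * 5 * \<alpha> powi (int n - 1) * \<bar>x\<bar> ^ 3"
        using 3 by (intro error_system_step[OF \<alpha> D]) auto
      also have "\<dots> \<le> 1 * 5 * \<alpha> powi (int n - 1) * \<bar>x\<bar> ^ 3"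
        using \<alpha> by (intro mult_right_mono) (auto simp: step_factor_def power_divide)
      finally show ?thesis by simp
    qed
  qed
  from this[of x "nat (k + 1)"] show ?thesis
    using assms by simp
qed

text \<open>Since the recurrence reaches back to \<open>k - 2\<close>, each doubling of the interval
  raises the threshold on \<open>k\<close> by 2. Choosing \<open>M\<close> before \<open>D\<close>
  makes it uniform.\<close>

lemma error_system_bound:
  assumes \<alpha>: "0 < \<alpha>" "\<alpha> \<le> 3 / 4" "\<alpha>\<^sup>2 = 1 / 2"
  shows "\<exists>M>0. \<forall>D. error_system D \<longrightarrow>
    (\<forall>k\<ge>2 * int n - 1. \<forall>x. \<bar>x\<bar> \<le> 2 ^ n * (pi / 4) \<longrightarrow> \<bar>D k x\<bar> \<le> M * \<alpha> powi k * \<bar>x\<bar> ^ 3)"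
proof (induction n)
  case 0
  then show ?case
    using error_system_base[OF \<alpha>] by (intro exI[of _ 5]) simp
next
  case (Suc n)
  then obtain M where "M > 0" and M: "\<And>D k x. error_system D \<Longrightarrow> k \<ge> 2 * int n - 1 \<Longrightarrow>
      \<bar>x\<bar> \<le> 2 ^ n * (pi / 4) \<Longrightarrow> \<bar>D k x\<bar> \<le> M * \<alpha> powi k * \<bar>x\<bar> ^ 3"
    by blast
  define T where "T = 2 ^ Suc n * (pi / 4)"
  have "\<bar>D k x\<bar> \<le> step_factor M T * M * \<alpha> powi k * \<bar>x\<bar> ^ 3"
    if "error_system D" "k \<ge> 2 * int (Suc n) - 1" "\<bar>x\<bar> \<le> T" for D k x
  proof -
    have "\<bar>x / 2\<bar> \<le> 2 ^ n * (pi / 4)" "\<bar>x / 4\<bar> \<le> \<bar>x / 2\<bar>"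
      using that(3) by (auto simp: T_def mult.commute)
    then show ?thesis
      using that \<open>M > 0\<close> by (intro error_system_step[OF \<alpha>] M) auto
  qed
  moreover have "step_factor M T * M > 0"
    using \<open>M > 0\<close> by (auto simp: step_factor_def T_def intro!: mult_pos_pos add_pos_nonneg)
  ultimately show ?case
    unfolding T_def by blast
qed

theorem theorem2p1:
  fixes \<alpha> :: real and m :: nat
  assumes "\<alpha> = 2 powr (-1/2)"
  shows "\<exists>Ct C :: real. Ct > 0 \<and> C > 0 \<and>
    (\<forall>(P :: int \<Rightarrow> real poly) (\<rho> :: real) (x0 :: real).
       regular_germ 1 1 \<rho> x0 (P (-1)) (P 0) \<longrightarrow>
       (\<forall>k\<ge>1. P k = (P (k - 2))\<^sup>2 * (P (k - 1) - 2) + 2) \<longrightarrow>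
       (\<forall>k\<ge>2 * int m + 1. \<forall>x\<in>{- (2 powi (int m - 1) * pi) .. 2 powi (int m - 1) * pi}.
          \<bar>Delta \<rho> x0 k (P k) x\<bar> \<le> Ct * \<alpha> powi k * \<bar>x\<bar> ^ 3 \<and>
          Ct * \<alpha> powi k * \<bar>x\<bar> ^ 3 \<le> C * \<alpha> powi k))"
proof -
  define R where "R = 2 powi (int m - 1) * pi"
  \<comment> \<open>The required interval is reached after \<open>Suc m\<close> doublings from
    \<open>pi / 4\<close>, where the threshold on \<open>k\<close> is
    \<open>2 * int m + 1\<close>.\<close>
  have R: "R > 0" "2 ^ Suc m * (pi / 4) = R"
    by (simp_all add: R_def power_int_diff)
  have "\<alpha> > 0"
    using assms by simp
  have sq: "\<alpha>\<^sup>2 = 1 / 2"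
    using assms by (simp add: power2_eq_square powr_minus_divide flip: powr_add)
  \<comment> \<open>Compare squares: \<open>1 / 2 \<le> 9 / 16\<close>.\<close>
  have "\<alpha> \<le> 3 / 4"
    by (rule power2_le_imp_le) (simp_all add: sq power_divide)
  then obtain M where "M > 0" and M: "\<And>D k x. error_system D \<Longrightarrow> k \<ge> 2 * int m + 1 \<Longrightarrow>
      \<bar>x\<bar> \<le> R \<Longrightarrow> \<bar>D k x\<bar> \<le> M * \<alpha> powi k * \<bar>x\<bar> ^ 3"
    using error_system_bound[OF \<open>\<alpha> > 0\<close> _ sq, of "Suc m"] unfolding R by auto
  have "\<bar>Delta \<rho> x0 k (P k) x\<bar> \<le> M * \<alpha> powi k * \<bar>x\<bar> ^ 3 \<and>
      M * \<alpha> powi k * \<bar>x\<bar> ^ 3 \<le> M * R ^ 3 * \<alpha> powi k"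
    if "regular_germ 1 1 \<rho> x0 (P (-1)) (P 0)"
      "\<forall>k\<ge>1. P k = (P (k - 2))\<^sup>2 * (P (k - 1) - 2) + 2"
      "k \<ge> 2 * int m + 1" "x \<in> {- R .. R}" for P \<rho> x0 k x
  proof
    have x: "\<bar>x\<bar> \<le> R"
      using that(4) by auto
    show "\<bar>Delta \<rho> x0 k (P k) x\<bar> \<le> M * \<alpha> powi k * \<bar>x\<bar> ^ 3"
      using M[OF error_system_Delta[OF that(1,2)] that(3) x] .
    have "M * \<alpha> powi k * \<bar>x\<bar> ^ 3 \<le> M * \<alpha> powi k * R ^ 3"
      using x \<open>M > 0\<close> \<open>\<alpha> > 0\<close> by (intro mult_left_mono power_mono) auto
    then show "M * \<alpha> powi k * \<bar>x\<bar> ^ 3 \<le> M * R ^ 3 * \<alpha> powi k"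
      by (simp add: mult_ac)
  qed
  moreover have "M * R ^ 3 > 0"
    using \<open>M > 0\<close> R by simp
  ultimately show ?thesis
    using \<open>M > 0\<close> unfolding R_def by blast
qed

end
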